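(* Let $(X,\tau)$ be a locally convex space where $\tau$ is induced by a directed family $\mathcal{P}$ of seminorms, and let $Y$ be a closed subspace of $X$. Then the following are equivalent. (a) $Y$ has the property-USNP in $X$ (with respect to $\mathcal{P}$). (b) For every closed subspace $Z\neq\{0\}$ of $Y$, $Y/Z$ has the property-USNP in $X/Z$ (with respect to $\dot{\mathcal{P}}$). (c) For every nonzero hyperplane $Z$ in $Y$, $Y/Z$ has the property-USNP in $X/Z$ (with respect to $\dot{\mathcal{P}}$).
   Context: Scalars are real. $\mathcal{P}$ is directed if for all $\rho_1,\rho_2\in\mathcal{P}$ there is $\rho_3\in\mathcal{P}$ with $\rho_3\ge\max\{\rho_1,\rho_2\}$ pointwise. A hyperplane in $Y$ is a subspace of the form $f^{-1}(0)$ for some $f\in Y^*$. For a closed subspace $Z$ of $X$, the quotient topology on $X/Z$ is induced by $\dot{\mathcal{P}}=\{\dot\rho:\rho\in\mathcal{P}\}$, where $\dot\rho(x+Z)=\inf\{\rho(x-z):z\in Z\}$. For a locally convex space $V$ with topology induced by a directed family $\mathcal{Q}$ of seminorms, a subspace $W$ of $V$ (with the subspace topology), continuous duals $V^*,W^*$, and $\rho\in\mathcal{Q}$, put $\chi_\rho^V(f)=\sup\{|f(v)|:v\in V,\rho(v)\le1\}\in[0,\infty]$ for $f\in V^*$ and $\chi_\rho^W(h)=\sup\{|h(v)|:v\in W,\rho(v)\le1\}\in[0,\infty]$ for $h\in W^*$. For $h\in W^*$ and $\rho\in\mathcal{Q}$ with $\chi_\rho^W(h)<\infty$, a Hahn-Banach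 extension (HBE) of the pair $(h,\rho)$ is an $\widetilde h\in V^*$ with $\widetilde h|_W=h$ and $\chi_\rho^V(\widetilde h)=\chi_\rho^W(h)$. $W$ has property-USNP in $V$ (with respect to $\mathcal{Q}$) if for every $h\in W^*$ there is $\widetilde h\in V^*$ which is the unique HBE of $(h,\rho)$ for every $\rho\in\mathcal{Q}$ with $\chi_\rho^W(h)<\infty$ (the same $\widetilde h$ for all these $\rho$).
   Formalization: The formal theorem additionally assumes that Y is not one-dimensional; without this the equivalence fails, e.g. for X = R^2 with the l1-norm and Y = span{e1}, where (b) and (c) hold trivially but (a) fails. *)

theory Defs
  imports "HOL-Analysis.Analysis"
begin

definition seminorm :: "('a::real_vector \<Rightarrow> real) \<Rightarrow> bool" where
  "seminorm \<rho> \<longleftrightarrow>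
     (\<forall>x y. \<rho> (x + y) \<le> \<rho> x + \<rho> y) \<and> (\<forall>c x. \<rho> (c *\<^sub>R x) = \<bar>c\<bar> * \<rho> x)"

definition directed_family :: "('v \<Rightarrow> real) set \<Rightarrow> bool" where
  "directed_family P \<longleftrightarrow>
     (\<forall>\<rho>\<^sub>1\<in>P. \<forall>\<rho>\<^sub>2\<in>P. \<exists>\<rho>\<^sub>3\<in>P. \<forall>x. max (\<rho>\<^sub>1 x) (\<rho>\<^sub>2 x) \<le> \<rho>\<^sub>3 x)"

text \<open>
  The quotient \<open>X/Z\<close> depends on the set \<open>Z\<close>, so it cannot be a type of class \<open>real_vector\<close>.
  The notions below are therefore stated for vector spaces with an explicit carrier and explicit
  operations, and are used both for \<open>X\<close> itself (\<open>type_vs\<close>) and for \<open>X/Z\<close> (\<open>quot_vs\<close>).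
\<close>

record 'v vs =
  vs_carrier :: "'v set"
  vs_add :: "'v \<Rightarrow> 'v \<Rightarrow> 'v"
  vs_scale :: "real \<Rightarrow> 'v \<Rightarrow> 'v"

definition type_vs :: "('a::real_vector) vs" where
  "type_vs = \<lparr>vs_carrier = UNIV, vs_add = (+), vs_scale = (*\<^sub>R)\<rparr>"

definition coset :: "'a::real_vector set \<Rightarrow> 'a \<Rightarrow> 'a set" where
  "coset Z x = {x + z | z. z \<in> Z}"

text \<open>
  For a subspace \<open>Y\<close> with \<open>Z \<subseteq> Y\<close>, the set \<open>quot Y Z\<close> is \<open>Y/Z\<close>, regarded as a subset of \<open>X/Z\<close>.
\<close>

definition quot :: "'a::real_vector set \<Rightarrow> 'a set \<Rightarrow> 'a set set" where
  "quot Y Z = coset Z ` Y"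

text \<open>
  Adding \<open>z\<close> in the scalar multiplication matters only for \<open>c = 0\<close>, where the result has to be \<open>Z\<close>
  and not \<open>{0}\<close>; see \<open>quot_vs_add\<close> and \<open>quot_vs_scale\<close>.
\<close>

definition quot_vs :: "'a::real_vector set \<Rightarrow> 'a set vs" where
  "quot_vs Z = \<lparr>vs_carrier = quot UNIV Z,
                vs_add = (\<lambda>A B. {a + b | a b. a \<in> A \<and> b \<in> B}),
                vs_scale = (\<lambda>c A. {c *\<^sub>R a + z | a z. a \<in> A \<and> z \<in> Z})\<rparr>"

text \<open>
  Since \<open>{x - z | z. z \<in> Z}\<close> is the coset of \<open>x\<close>, the infimum of \<open>\<rho> (x - z)\<close> over \<open>z \<in> Z\<close> is the
  infimum of \<open>\<rho>\<close> over this coset; see \<open>quot_seminorm_coset\<close>.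
\<close>

definition quot_seminorm :: "('a \<Rightarrow> real) \<Rightarrow> 'a set \<Rightarrow> real" where
  "quot_seminorm \<rho> A = Inf (\<rho> ` A)"

text \<open>
  The carrier is added to the subbasis of open balls so that it is the whole space even for \<open>Q = {}\<close>.
\<close>

definition seminorm_topology :: "'v vs \<Rightarrow> ('v \<Rightarrow> real) set \<Rightarrow> 'v topology" where
  "seminorm_topology V Q = topology_generated_by
     (insert (vs_carrier V)
        {{y \<in> vs_carrier V. \<rho> (vs_add V y (vs_scale V (-1) x)) < r} | \<rho> x r.
           \<rho> \<in> Q \<and> x \<in> vs_carrier V \<and> r > 0})"

text \<open>
  The continuous dual of the subspace \<open>W\<close> of \<open>V\<close> with the subspace topology; the dual of \<open>V\<close> is the
  case \<open>W = vs_carrier V\<close>. Functionals are extensional, so that equality in the dual is equality on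
  \<open>W\<close>.
\<close>

definition dual :: "'v vs \<Rightarrow> ('v \<Rightarrow> real) set \<Rightarrow> 'v set \<Rightarrow> ('v \<Rightarrow> real) set" where
  "dual V Q W = {f \<in> extensional W.
     (\<forall>x\<in>W. \<forall>y\<in>W. f (vs_add V x y) = f x + f y) \<and>
     (\<forall>c. \<forall>x\<in>W. f (vs_scale V c x) = c * f x) \<and>
     continuous_map (subtopology (seminorm_topology V Q) W) euclideanreal f}"

definition chi :: "'v set \<Rightarrow> ('v \<Rightarrow> real) \<Rightarrow> ('v \<Rightarrow> real) \<Rightarrow> ennreal" where
  "chi W \<rho> f = (SUP v\<in>{v \<in> W. \<rho> v \<le> 1}. ennreal \<bar>f v\<bar>)"

definition HBE ::
  "'v vs \<Rightarrow> ('v \<Rightarrow> real) set \<Rightarrow> 'v set \<Rightarrow> ('v \<Rightarrow> real) \<Rightarrow> ('v \<Rightarrow> real) \<Rightarrow> ('v \<Rightarrow> real) \<Rightarrow> bool" where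
  "HBE V Q W h \<rho> g \<longleftrightarrow>
     g \<in> dual V Q (vs_carrier V) \<and> restrict g W = h \<and> chi (vs_carrier V) \<rho> g = chi W \<rho> h"

definition USNP :: "'v vs \<Rightarrow> ('v \<Rightarrow> real) set \<Rightarrow> 'v set \<Rightarrow> bool" where
  "USNP V Q W \<longleftrightarrow>
     (\<forall>h \<in> dual V Q W. \<exists>g \<in> dual V Q (vs_carrier V).
        \<forall>\<rho>\<in>Q. chi W \<rho> h < \<infinity> \<longrightarrow> HBE V Q W h \<rho> g \<and> (\<forall>g'. HBE V Q W h \<rho> g' \<longrightarrow> g' = g))"

definition hyperplane_in :: "'v vs \<Rightarrow> ('v \<Rightarrow> real) set \<Rightarrow> 'v set \<Rightarrow> 'v set \<Rightarrow> bool" where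
  "hyperplane_in V Q W Z \<longleftrightarrow> (\<exists>f \<in> dual V Q W. Z = {x \<in> W. f x = 0})"

lemma quot_vs_add:
  assumes "subspace Z"
  shows "vs_add (quot_vs Z) (coset Z x) (coset Z y) = coset Z (x + y)"
proof -
  have "{a + b | a b. a \<in> coset Z x \<and> b \<in> coset Z y} = coset Z (x + y)" (is "?L = _")
  proof (intro equalityI subsetI)
    fix v assume "v \<in> ?L"
    then obtain u w where "u \<in> Z" "w \<in> Z" and v: "v = (x + u) + (y + w)"
      unfolding coset_def by blast
    then have "u + w \<in> Z" "v = x + y + (u + w)"
      using assms by (simp_all add: subspace_add)
    then show "v \<in> coset Z (x + y)" unfolding coset_def by blast
  next
    fix v assume "v \<in> coset Z (x + y)"
    then obtain z where z: "z \<in> Z" "v = x + y + z" unfolding coset_def by blast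
    then have "v = (x + z) + (y + 0)" by simp
    moreover have "x + z \<in> coset Z x" "y + 0 \<in> coset Z y"
      using z(1) subspace_0[OF assms] unfolding coset_def by blast+
    ultimately show "v \<in> ?L" by blast
  qed
  then show ?thesis by (simp add: quot_vs_def)
qed

lemma quot_vs_scale:
  assumes "subspace Z"
  shows "vs_scale (quot_vs Z) c (coset Z x) = coset Z (c *\<^sub>R x)"
proof -
  have "{c *\<^sub>R a + z | a z. a \<in> coset Z x \<and> z \<in> Z} = coset Z (c *\<^sub>R x)" (is "?L = _")
  proof (intro equalityI subsetI)
    fix v assume "v \<in> ?L"
    then obtain u w where "u \<in> Z" "w \<in> Z" and v: "v = c *\<^sub>R (x + u) + w"
      unfolding coset_def by blast
    then have "c *\<^sub>R u + w \<in> Z" "v = c *\<^sub>R x + (c *\<^sub>R u + w)"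
      using assms by (simp_all add: subspace_add subspace_scale scaleR_add_right)
    then show "v \<in> coset Z (c *\<^sub>R x)" unfolding coset_def by blast
  next
    fix v assume "v \<in> coset Z (c *\<^sub>R x)"
    then obtain z where z: "z \<in> Z" "v = c *\<^sub>R x + z" unfolding coset_def by blast
    then have "v = c *\<^sub>R (x + 0) + z" by simp
    moreover have "x + 0 \<in> coset Z x"
      using subspace_0[OF assms] unfolding coset_def by blast
    ultimately show "v \<in> ?L" using z(1) by blast
  qed
  then show ?thesis by (simp add: quot_vs_def)
qed

lemma quot_seminorm_coset:
  assumes "subspace Z"
  shows "quot_seminorm \<rho> (coset Z x) = Inf {\<rho> (x - z) | z. z \<in> Z}"
proof -
  have "coset Z x = (\<lambda>z. x - z) ` Z"
  proof (intro equalityI subsetI)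
    fix v assume "v \<in> coset Z x"
    then obtain z where "z \<in> Z" "v = x + z" unfolding coset_def by blast
    then have "- z \<in> Z" "v = x - (- z)" using subspace_neg[OF assms] by auto
    then show "v \<in> (\<lambda>z. x - z) ` Z" by blast
  next
    fix v assume "v \<in> (\<lambda>z. x - z) ` Z"
    then obtain z where "z \<in> Z" "v = x - z" by blast
    then have "- z \<in> Z" "v = x + (- z)" using subspace_neg[OF assms] by auto
    then show "v \<in> coset Z x" unfolding coset_def by blast
  qed
  moreover have "\<rho> ` (\<lambda>z. x - z) ` Z = {\<rho> (x - z) | z. z \<in> Z}" by blast
  ultimately show ?thesis by (simp add: quot_seminorm_def)
qed

end

theory Submission
  imports Defs
begin

text \<open>
  A linear functional with \<open>chi W \<rho> h < \<infinity>\<close> is dominated by a multiple of \<open>\<rho>\<close>, hence continuous, so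
  property-USNP is a statement about linear functionals and the numbers \<open>chi W \<rho> h\<close> only.
  Composition with the quotient map identifies the functionals on \<open>W/Z\<close> with those on \<open>W\<close> that
  vanish on \<open>Z\<close>, and it preserves \<open>chi\<close>. An extension to \<open>X\<close> of a functional on \<open>Y\<close> vanishing on \<open>Z\<close>
  again vanishes on \<open>Z\<close>, so the extension problems for \<open>h\<close> and for the induced functional on
  \<open>Y/Z\<close> are the same. For (c) \<open>\<Longrightarrow>\<close> (a) take \<open>Z\<close> to be the kernel of \<open>h\<close>; it is nonzero since \<open>Y\<close> is
  not one-dimensional.
\<close>

text \<open>The algebraic part of \<open>dual\<close>; continuity is left out because a finite
  \<open>chi\<close> restores it.\<close>

definition functionals :: "'v vs \<Rightarrow> 'v set \<Rightarrow> ('v \<Rightarrow> real) set" where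
  "functionals V W = {f \<in> extensional W.
     (\<forall>x\<in>W. \<forall>y\<in>W. f (vs_add V x y) = f x + f y) \<and> (\<forall>c. \<forall>x\<in>W. f (vs_scale V c x) = c * f x)}"

definition norm_extension ::
  "'v vs \<Rightarrow> 'v set \<Rightarrow> ('v \<Rightarrow> real) \<Rightarrow> ('v \<Rightarrow> real) \<Rightarrow> ('v \<Rightarrow> real) \<Rightarrow> bool" where
  "norm_extension V W h \<rho> g \<longleftrightarrow>
     g \<in> functionals V (vs_carrier V) \<and> restrict g W = h \<and> chi (vs_carrier V) \<rho> g = chi W \<rho> h"

text \<open>As in \<open>USNP\<close>, one \<open>g\<close> has to serve all \<open>\<rho>\<close>
  with finite \<open>chi\<close>. Nothing is asked of \<open>g\<close> when there is no such
  \<open>\<rho>\<close>; that case is treated in \<open>USNP_iff\<close>.\<close>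

definition unique_norm_extension ::
  "'v vs \<Rightarrow> ('v \<Rightarrow> real) set \<Rightarrow> 'v set \<Rightarrow> ('v \<Rightarrow> real) \<Rightarrow> bool" where
  "unique_norm_extension V Q W h \<longleftrightarrow>
     (\<exists>g. \<forall>\<rho>\<in>Q. chi W \<rho> h < \<infinity> \<longrightarrow>
        norm_extension V W h \<rho> g \<and> (\<forall>g'. norm_extension V W h \<rho> g' \<longrightarrow> g' = g))"

text \<open>Restricting to \<open>W\<close> keeps the pullback extensional, so that equality of
  pullbacks is equality on \<open>W\<close>.\<close>

definition pull :: "'a::real_vector set \<Rightarrow> 'a set \<Rightarrow> ('a set \<Rightarrow> real) \<Rightarrow> 'a \<Rightarrow> real" where
  "pull Z W f = (\<lambda>x\<in>W. f (coset Z x))"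

section \<open>Seminorms and continuity\<close>

lemma seminorm_0: "seminorm \<rho> \<Longrightarrow> \<rho> 0 = 0"
  unfolding seminorm_def by (metis abs_zero mult_zero_left scaleR_zero_left)

lemma seminorm_scale: "seminorm \<rho> \<Longrightarrow> \<rho> (c *\<^sub>R x) = \<bar>c\<bar> * \<rho> x"
  unfolding seminorm_def by blast

lemma seminorm_nonneg:
  assumes "seminorm \<rho>" shows "0 \<le> \<rho> x"
proof -
  have "\<rho> (x + (-1) *\<^sub>R x) \<le> \<rho> x + \<rho> ((-1) *\<^sub>R x)"
    using assms unfolding seminorm_def by blast
  then show ?thesis using seminorm_0[OF assms] seminorm_scale[OF assms, of "-1" x] by simp
qed

lemma type_vs_simps [simp]:
  "vs_carrier type_vs = UNIV" "vs_add type_vs = (+)" "vs_scale type_vs = (*\<^sub>R)"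
  by (simp_all add: type_vs_def)

lemma functionals_add:
  "f \<in> functionals V W \<Longrightarrow> x \<in> W \<Longrightarrow> y \<in> W \<Longrightarrow> f (vs_add V x y) = f x + f y"
  by (simp add: functionals_def)

lemma functionals_scale:
  "f \<in> functionals V W \<Longrightarrow> x \<in> W \<Longrightarrow> f (vs_scale V c x) = c * f x"
  by (simp add: functionals_def)

lemma dual_functionals: "f \<in> dual V Q W \<Longrightarrow> f \<in> functionals V W"
  by (simp add: dual_def functionals_def)

lemma topspace_seminorm_topology: "topspace (seminorm_topology V Q) = vs_carrier V"
  unfolding seminorm_topology_def topology_generated_by_topspace by auto

lemma openin_seminorm_ball:
  assumes "\<rho> \<in> Q" "x \<in> vs_carrier V" "0 < r"
  shows "openin (seminorm_topology V Q)
           {y \<in> vs_carrier V. \<rho> (vs_add V y (vs_scale V (-1) x)) < r}"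
  unfolding seminorm_topology_def
  by (rule topology_generated_by_Basis) (use assms in blast)

text \<open>A Lipschitz estimate against a single member of \<open>Q\<close> suffices, since its
  balls are open by construction. \<open>V\<close> and \<open>\<rho>\<close> are left general so
  that both X and X/Z are covered; \<open>zero\<close> puts each centre into its own ball.\<close>

lemma continuous_map_seminorm_bound:
  assumes "\<rho> \<in> Q" "W \<subseteq> vs_carrier V" "0 \<le> C"
    and zero: "\<And>x. x \<in> W \<Longrightarrow> \<rho> (vs_add V x (vs_scale V (-1) x)) \<le> 0"
    and bound: "\<And>x y. x \<in> W \<Longrightarrow> y \<in> W \<Longrightarrow> \<bar>f y - f x\<bar> \<le> C * \<rho> (vs_add V y (vs_scale V (-1) x))"
  shows "continuous_map (subtopology (seminorm_topology V Q) W) euclideanreal f"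
proof -
  let ?T = "subtopology (seminorm_topology V Q) W"
  have top: "topspace ?T = W"
    using assms(2) by (auto simp: topspace_seminorm_topology)
  have "\<exists>U. openin ?T U \<and> x \<in> U \<and> (\<forall>y\<in>U. f y \<in> ball (f x) e)"
    if "x \<in> W" "0 < e" for x e
  proof -
    \<comment> \<open>Dividing by \<open>C + 1\<close> instead of \<open>C\<close> admits
      \<open>C = 0\<close> and makes \<open>C * (e / (C + 1))\<close> strictly smaller than
      \<open>e\<close>.\<close>
    let ?B = "{y \<in> vs_carrier V. \<rho> (vs_add V y (vs_scale V (-1) x)) < e / (C + 1)}"
    have r: "0 < e / (C + 1)" using that assms(3) by simp
    have "openin ?T (?B \<inter> W)"
      using openin_seminorm_ball[OF assms(1) _ r] that(1) assms(2)
      by (auto simp: openin_subtopology)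
    moreover have "x \<in> ?B \<inter> W" using zero[OF that(1)] r that(1) assms(2) by auto
    moreover have "f y \<in> ball (f x) e" if "y \<in> ?B \<inter> W" for y
    proof -
      have "\<bar>f y - f x\<bar> \<le> C * \<rho> (vs_add V y (vs_scale V (-1) x))"
        using bound \<open>x \<in> W\<close> that by blast
      also have "\<dots> \<le> C * (e / (C + 1))"
        using that assms(3) by (intro mult_left_mono) auto
      also have "\<dots> < e" using \<open>0 < e\<close> assms(3) by (simp add: field_simps)
      finally show ?thesis by (simp add: dist_real_def abs_minus_commute)
    qed
    ultimately show ?thesis by blast
  qed
  then show ?thesis
    unfolding mtopology_is_euclidean[symmetric] Met_TC.continuous_map_to_metric top mball_eq_ball
    by blast
qed

section \<open>\<open>chi\<close> as the best constant in a bound by a seminorm\<close>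

text \<open>Reduces an inequality between two values of \<open>chi\<close> to real bounds, to which
  \<open>chi_le_iff\<close> applies; for infinite \<open>b\<close> there is nothing to show.\<close>

lemma ennreal_le_of_real_bounds:
  assumes "\<And>C. 0 \<le> C \<Longrightarrow> b \<le> ennreal C \<Longrightarrow> a \<le> ennreal C"
  shows "a \<le> b"
  using assms by (cases b) auto

text \<open>By homogeneity, a bound on the unit ball of \<open>\<rho>\<close> is the same as a bound
  by a multiple of \<open>\<rho>\<close> on all of \<open>W\<close>.\<close>

lemma chi_le_iff:
  assumes "seminorm \<rho>" "subspace W" "f \<in> functionals type_vs W" "0 \<le> C"
  shows "chi W \<rho> f \<le> ennreal C \<longleftrightarrow> (\<forall>x\<in>W. \<bar>f x\<bar> \<le> C * \<rho> x)"
proof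
  assume "chi W \<rho> f \<le> ennreal C"
  then have ball: "\<bar>f x\<bar> \<le> C" if "x \<in> W" "\<rho> x \<le> 1" for x
    using that assms(4) unfolding chi_def SUP_le_iff by auto
  show "\<forall>x\<in>W. \<bar>f x\<bar> \<le> C * \<rho> x"
  proof
    fix x assume x: "x \<in> W"
    \<comment> \<open>Since \<open>\<rho> x\<close> may be 0, \<open>x\<close> is scaled into the
      unit ball by some \<open>t > \<rho> x\<close>; afterwards \<open>t\<close> approaches
      \<open>\<rho> x\<close>.\<close>
    have scaled: "\<bar>f x\<bar> \<le> C * t" if "\<rho> x < t" for t
    proof -
      have t: "0 < t" using that seminorm_nonneg[OF assms(1), of x] by linarith
      have "f (inverse t *\<^sub>R x) = inverse t * f x"
        using assms(3) x by (simp add: functionals_def type_vs_def)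
      moreover have "\<bar>f (inverse t *\<^sub>R x)\<bar> \<le> C"
        using that t x assms(2)
        by (intro ball) (simp_all add: subspace_scale seminorm_scale[OF assms(1)] field_simps)
      ultimately have "inverse t * \<bar>f x\<bar> \<le> C" using t by (simp add: abs_mult)
      then show ?thesis using t by (simp add: field_simps)
    qed
    show "\<bar>f x\<bar> \<le> C * \<rho> x"
    proof (rule field_le_epsilon)
      fix e :: real assume e: "0 < e"
      have "\<bar>f x\<bar> \<le> C * (\<rho> x + e / (C + 1))"
        using scaled[of "\<rho> x + e / (C + 1)"] e assms(4) by simp
      also have "\<dots> \<le> C * \<rho> x + e"
        using e assms(4) by (simp add: field_simps)
      finally show "\<bar>f x\<bar> \<le> C * \<rho> x + e" .
    qed
  qed
next
  assume b: "\<forall>x\<in>W. \<bar>f x\<bar> \<le> C * \<rho> x"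
  show "chi W \<rho> f \<le> ennreal C"
    unfolding chi_def
  proof (rule SUP_least)
    fix x assume x: "x \<in> {v \<in> W. \<rho> v \<le> 1}"
    then have "\<bar>f x\<bar> \<le> C * \<rho> x" using b by blast
    also have "\<dots> \<le> C * 1" using x assms(4) by (intro mult_left_mono) auto
    finally show "ennreal \<bar>f x\<bar> \<le> ennreal C" by (simp add: ennreal_leI)
  qed
qed

text \<open>By linearity, the finite value of \<open>chi\<close> is a Lipschitz constant of
  \<open>f\<close> with respect to \<open>\<rho>\<close>.\<close>

lemma type_vs_functional_in_dual:
  assumes "seminorm \<rho>" "\<rho> \<in> Q" "subspace W" "f \<in> functionals type_vs W" "chi W \<rho> f < \<infinity>"
  shows "f \<in> dual type_vs Q W"
proof -
  obtain C where C: "0 \<le> C" "chi W \<rho> f = ennreal C"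
    using assms(5) by (cases "chi W \<rho> f") auto
  then have b: "\<forall>x\<in>W. \<bar>f x\<bar> \<le> C * \<rho> x"
    using chi_le_iff[OF assms(1,3,4) C(1)] by simp
  have "continuous_map (subtopology (seminorm_topology type_vs Q) W) euclideanreal f"
  proof (rule continuous_map_seminorm_bound[OF assms(2) _ C(1)])
    fix x y assume xy: "x \<in> W" "y \<in> W"
    then have mem: "(-1) *\<^sub>R x \<in> W" "y + (-1) *\<^sub>R x \<in> W"
      using assms(3) by (meson subspace_add subspace_scale)+
    have "f (y + (-1) *\<^sub>R x) = f y + (-1) * f x"
      using functionals_add[OF assms(4) xy(2) mem(1)] functionals_scale[OF assms(4) xy(1), of "-1"]
      by simp
    moreover have "y + (-1) *\<^sub>R x \<in> W" by (fact mem(2))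
    ultimately show "\<bar>f y - f x\<bar> \<le> C * \<rho> (vs_add type_vs y (vs_scale type_vs (-1) x))"
      using b by (auto simp: type_vs_def dest: bspec)
  qed (simp_all add: type_vs_def seminorm_0[OF assms(1)])
  then show ?thesis using assms(4) by (simp add: dual_def functionals_def)
qed

section \<open>Functionals on a quotient\<close>

lemma coset_eq:
  assumes "subspace Z" "x - y \<in> Z"
  shows "coset Z x = coset Z y"
proof -
  have "coset Z u \<subseteq> coset Z v" if "u - v \<in> Z" for u v
  proof
    fix w assume "w \<in> coset Z u"
    then obtain z where "z \<in> Z" "w = v + ((u - v) + z)" unfolding coset_def by auto
    then show "w \<in> coset Z v" using that subspace_add[OF assms(1)] unfolding coset_def by blast
  qed
  then show ?thesis
    using assms subspace_neg[OF assms(1,2)] by (metis equalityI minus_diff_eq)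
qed

lemma quot_seminorm_le:
  assumes "seminorm \<rho>" "subspace Z"
  shows "quot_seminorm \<rho> (coset Z x) \<le> \<rho> x"
  unfolding quot_seminorm_def
proof (rule cINF_lower)
  show "bdd_below (\<rho> ` coset Z x)"
    using seminorm_nonneg[OF assms(1)] by (auto intro: bdd_belowI[of _ 0])
  show "x \<in> coset Z x"
    using subspace_0[OF assms(2)] unfolding coset_def by force
qed

text \<open>The coset of \<open>x\<close> stays inside \<open>W\<close> and
  \<open>pull Z W f\<close> is constant on it, so the bound holds at every representative and passes
  to the infimum.\<close>

lemma quot_functional_bound:
  assumes "seminorm \<rho>" "subspace Z" "subspace W" "Z \<subseteq> W" "0 \<le> C"
    and b: "\<forall>x\<in>W. \<bar>pull Z W f x\<bar> \<le> C * \<rho> x" and "x \<in> W"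
  shows "\<bar>f (coset Z x)\<bar> \<le> C * quot_seminorm \<rho> (coset Z x)"
proof -
  have w: "\<bar>f (coset Z x)\<bar> \<le> C * \<rho> w" if w: "w \<in> coset Z x" for w
  proof -
    obtain z where z: "z \<in> Z" "w = x + z" using w unfolding coset_def by blast
    then have "w \<in> W" using assms(3,4,7) subspace_add by blast
    moreover have "coset Z w = coset Z x" using z by (intro coset_eq[OF assms(2)]) simp
    ultimately show ?thesis using b by (metis pull_def restrict_apply')
  qed
  have x: "x \<in> coset Z x" using subspace_0[OF assms(2)] unfolding coset_def by force
  show ?thesis
  \<comment> \<open>The infimum is taken after division by \<open>C\<close>; for
    \<open>C = 0\<close> the bound at the representative \<open>x\<close> is already enough.\<close>
  proof (cases "C = 0")
    case True
    then show ?thesis using w[OF x] by simp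
  next
    case False
    then have "\<bar>f (coset Z x)\<bar> / C \<le> quot_seminorm \<rho> (coset Z x)"
      unfolding quot_seminorm_def using w x assms(5)
      by (intro cINF_greatest) (auto simp: field_simps)
    then show ?thesis using False assms(5) by (simp add: field_simps)
  qed
qed

lemma pull_functionals:
  assumes "subspace Z" "subspace W" "f \<in> functionals (quot_vs Z) (quot W Z)"
  shows "pull Z W f \<in> functionals type_vs W"
proof -
  have mem: "coset Z x \<in> quot W Z" if "x \<in> W" for x
    using that unfolding quot_def by (rule imageI)
  have "f (coset Z (x + y)) = f (coset Z x) + f (coset Z y)" if "x \<in> W" "y \<in> W" for x y
    using functionals_add[OF assms(3) mem[OF that(1)] mem[OF that(2)]]
    unfolding quot_vs_add[OF assms(1)] .
  moreover have "f (coset Z (c *\<^sub>R x)) = c * f (coset Z x)" if "x \<in> W" for c x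
    using functionals_scale[OF assms(3) mem[OF that], of c]
    unfolding quot_vs_scale[OF assms(1)] .
  ultimately show ?thesis
    using subspace_add[OF assms(2)] subspace_scale[OF assms(2)]
    by (simp add: functionals_def pull_def)
qed

text \<open>The quotient map sends the unit ball of \<open>\<rho>\<close> into that of
  \<open>quot_seminorm \<rho>\<close>, which gives one inequality. The infimum need not be attained,
  so the other one does not lift points of the ball but transfers every bound \<open>C\<close> by
  \<open>quot_functional_bound\<close>.\<close>

lemma chi_pull:
  assumes "seminorm \<rho>" "subspace Z" "subspace W" "Z \<subseteq> W"
    and f: "f \<in> functionals (quot_vs Z) (quot W Z)"
  shows "chi W \<rho> (pull Z W f) = chi (quot W Z) (quot_seminorm \<rho>) f"
proof (rule antisym)
  show "chi W \<rho> (pull Z W f) \<le> chi (quot W Z) (quot_seminorm \<rho>) f"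
    unfolding chi_def
  proof (rule SUP_mono)
    fix x assume "x \<in> {v \<in> W. \<rho> v \<le> 1}"
    then show "\<exists>A\<in>{A \<in> quot W Z. quot_seminorm \<rho> A \<le> 1}.
        ennreal \<bar>pull Z W f x\<bar> \<le> ennreal \<bar>f A\<bar>"
      using quot_seminorm_le[OF assms(1,2), of x]
      by (intro bexI[of _ "coset Z x"]) (auto simp: pull_def quot_def)
  qed
  show "chi (quot W Z) (quot_seminorm \<rho>) f \<le> chi W \<rho> (pull Z W f)"
  proof (rule ennreal_le_of_real_bounds)
    fix C :: real assume C: "0 \<le> C" "chi W \<rho> (pull Z W f) \<le> ennreal C"
    then have b: "\<forall>x\<in>W. \<bar>pull Z W f x\<bar> \<le> C * \<rho> x"
      using chi_le_iff[OF assms(1,3) pull_functionals[OF assms(2,3) f]] by blast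
    show "chi (quot W Z) (quot_seminorm \<rho>) f \<le> ennreal C"
      unfolding chi_def
    proof (rule SUP_least)
      fix A assume A: "A \<in> {A \<in> quot W Z. quot_seminorm \<rho> A \<le> 1}"
      then obtain x where x: "x \<in> W" "A = coset Z x" unfolding quot_def by blast
      have "\<bar>f A\<bar> \<le> C * quot_seminorm \<rho> A"
        using quot_functional_bound[OF assms(1-4) C(1) b x(1)] x(2) by simp
      also have "\<dots> \<le> C * 1" using A C(1) by (intro mult_left_mono) auto
      finally show "ennreal \<bar>f A\<bar> \<le> ennreal C" by (simp add: ennreal_leI)
    qed
  qed
qed

text \<open>The finite \<open>chi\<close> becomes a bound for the pullback on \<open>W\<close>, and
  this descends to a Lipschitz estimate for the quotient seminorm.\<close>

lemma quot_functional_in_dual: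
  assumes "seminorm \<rho>" "\<rho> \<in> P" "subspace Z" "subspace W" "Z \<subseteq> W"
    and f: "f \<in> functionals (quot_vs Z) (quot W Z)"
    and fin: "chi (quot W Z) (quot_seminorm \<rho>) f < \<infinity>"
  shows "f \<in> dual (quot_vs Z) (quot_seminorm ` P) (quot W Z)"
proof -
  obtain C where C: "0 \<le> C" "chi (quot W Z) (quot_seminorm \<rho>) f = ennreal C"
    using fin by (cases "chi (quot W Z) (quot_seminorm \<rho>) f") auto
  then have "chi W \<rho> (pull Z W f) \<le> ennreal C"
    by (simp add: chi_pull[OF assms(1,3-5) f])
  then have b: "\<forall>x\<in>W. \<bar>pull Z W f x\<bar> \<le> C * \<rho> x"
    using chi_le_iff[OF assms(1,4) pull_functionals[OF assms(3,4) f] C(1)] by blast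
  have "continuous_map (subtopology (seminorm_topology (quot_vs Z) (quot_seminorm ` P)) (quot W Z))
          euclideanreal f"
  proof (rule continuous_map_seminorm_bound[where \<rho> = "quot_seminorm \<rho>", OF _ _ C(1)])
    show "quot_seminorm \<rho> \<in> quot_seminorm ` P" using assms(2) by blast
    show "quot W Z \<subseteq> vs_carrier (quot_vs Z)" by (auto simp: quot_vs_def quot_def)
  next
    fix A assume "A \<in> quot W Z"
    then obtain x where "A = coset Z x" unfolding quot_def by blast
    then show "quot_seminorm \<rho> (vs_add (quot_vs Z) A (vs_scale (quot_vs Z) (-1) A)) \<le> 0"
      using quot_seminorm_le[OF assms(1,3), of 0] seminorm_0[OF assms(1)]
      by (simp add: quot_vs_add[OF assms(3)] quot_vs_scale[OF assms(3)])
  next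
    fix A B assume AB: "A \<in> quot W Z" "B \<in> quot W Z"
    then obtain x y where xy: "x \<in> W" "A = coset Z x" "y \<in> W" "B = coset Z y"
      unfolding quot_def by blast
    have mem: "(-1) *\<^sub>R x \<in> W" "y + (-1) *\<^sub>R x \<in> W"
      using xy assms(4) by (meson subspace_add subspace_scale)+
    have "vs_scale (quot_vs Z) (-1) A \<in> quot W Z"
      using mem(1) unfolding xy(2) quot_vs_scale[OF assms(3)] quot_def by (rule imageI)
    then have "f (vs_add (quot_vs Z) B (vs_scale (quot_vs Z) (-1) A)) = f B + (-1) * f A"
      using functionals_add[OF f AB(2)] functionals_scale[OF f AB(1)] by simp
    then show "\<bar>f B - f A\<bar> \<le> C * quot_seminorm \<rho>
        (vs_add (quot_vs Z) B (vs_scale (quot_vs Z) (-1) A))"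
      using quot_functional_bound[OF assms(1,3-5) C(1) b mem(2)] xy
      by (simp add: quot_vs_add[OF assms(3)] quot_vs_scale[OF assms(3)])
  qed
  then show ?thesis using f by (simp add: dual_def functionals_def)
qed

text \<open>Such a \<open>g\<close> is constant on cosets, so evaluating it at an arbitrarily chosen
  representative defines a functional on the quotient.\<close>

lemma functional_vanishing_is_pull:
  assumes "subspace Z" "subspace W" "Z \<subseteq> W"
    and g: "g \<in> functionals type_vs W" and van: "\<And>z. z \<in> Z \<Longrightarrow> g z = 0"
  obtains f where "f \<in> functionals (quot_vs Z) (quot W Z)" "pull Z W f = g"
proof -
  define f where "f = (\<lambda>A\<in>quot W Z. g (SOME x. x \<in> A))"
  have fc: "f (coset Z x) = g x" if x: "x \<in> W" for x
  proof -
    have "x \<in> coset Z x" using subspace_0[OF assms(1)] unfolding coset_def by force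
    then have "(SOME u. u \<in> coset Z x) \<in> coset Z x" by (rule someI)
    then obtain z where z: "z \<in> Z" "(SOME u. u \<in> coset Z x) = x + z"
      unfolding coset_def by blast
    have "g (x + z) = g x + g z"
      using functionals_add[OF g x] z(1) assms(3) by auto
    then show ?thesis using x z van by (simp add: f_def quot_def)
  qed
  have "f \<in> functionals (quot_vs Z) (quot W Z)"
    using g subspace_add[OF assms(2)] subspace_scale[OF assms(2)]
    by (auto simp: functionals_def type_vs_def quot_def fc
        quot_vs_add[OF assms(1)] quot_vs_scale[OF assms(1)])
      (auto simp: f_def quot_def)
  moreover have "pull Z W f = g"
    using g by (auto simp: pull_def fc functionals_def fun_eq_iff extensional_def)
  ultimately show ?thesis using that by blast
qed

text \<open>The quotient map from \<open>W\<close> to \<open>quot W Z\<close> is onto, and off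
  \<open>quot W Z\<close> both functionals agree by extensionality.\<close>

lemma pull_inject:
  assumes "f \<in> functionals V (quot W Z)" "g \<in> functionals V (quot W Z)" "pull Z W f = pull Z W g"
  shows "f = g"
proof (rule extensionalityI)
  show "f \<in> extensional (quot W Z)" "g \<in> extensional (quot W Z)"
    using assms(1,2) by (simp_all add: functionals_def)
  show "f A = g A" if "A \<in> quot W Z" for A
    using that assms(3) unfolding quot_def
    by (auto simp: pull_def dest: fun_cong split: if_splits)
qed

section \<open>Unique extensions\<close>

text \<open>Both sides force \<open>chi\<close> of \<open>g\<close> to equal the finite
  \<open>chi W \<rho> h\<close>, so the continuity of \<open>g\<close> is automatic.\<close>

lemma HBE_iff_norm_extension:
  assumes "\<And>g. g \<in> functionals V (vs_carrier V) \<Longrightarrow> chi (vs_carrier V) \<rho> g < \<infinity> \<Longrightarrow>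
             g \<in> dual V Q (vs_carrier V)"
    and "chi W \<rho> h < \<infinity>"
  shows "HBE V Q W h \<rho> g \<longleftrightarrow> norm_extension V W h \<rho> g"
  using assms dual_functionals unfolding HBE_def norm_extension_def by metis

lemma zero_in_dual:
  assumes "\<And>x y. x \<in> W \<Longrightarrow> y \<in> W \<Longrightarrow> vs_add V x y \<in> W"
    and "\<And>c x. x \<in> W \<Longrightarrow> vs_scale V c x \<in> W"
  shows "(\<lambda>x\<in>W. 0) \<in> dual V Q W"
proof -
  have "continuous_map (subtopology (seminorm_topology V Q) W) euclideanreal (\<lambda>x\<in>W. 0)"
    by (rule continuous_map_eq[where f = "\<lambda>_. 0"]) auto
  then show ?thesis using assms by (simp add: dual_def)
qed

text \<open>Once some \<open>\<rho>\<close> has finite \<open>chi\<close>, every linear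
  \<open>h\<close> is continuous by \<open>dW\<close>, and extensions of the same \<open>chi\<close>
  are continuous by \<open>dV\<close>. Thus the topology disappears from the property.\<close>

lemma USNP_iff:
  assumes dW: "\<And>f \<rho>. \<rho> \<in> Q \<Longrightarrow> f \<in> functionals V W \<Longrightarrow> chi W \<rho> f < \<infinity> \<Longrightarrow> f \<in> dual V Q W"
    and dV: "\<And>f \<rho>. \<rho> \<in> Q \<Longrightarrow> f \<in> functionals V (vs_carrier V) \<Longrightarrow> chi (vs_carrier V) \<rho> f < \<infinity> \<Longrightarrow>
               f \<in> dual V Q (vs_carrier V)"
    and zero: "(\<lambda>x\<in>vs_carrier V. 0) \<in> dual V Q (vs_carrier V)"
  shows "USNP V Q W \<longleftrightarrow>
    (\<forall>h\<in>functionals V W. \<forall>\<rho>\<in>Q. chi W \<rho> h < \<infinity> \<longrightarrow> unique_norm_extension V Q W h)"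
proof -
  have HBE: "HBE V Q W h \<rho> g \<longleftrightarrow> norm_extension V W h \<rho> g"
    if "\<rho> \<in> Q" "chi W \<rho> h < \<infinity>" for \<rho> h g
    using HBE_iff_norm_extension dV that by blast
  show ?thesis
  proof
    assume "USNP V Q W"
    then show "\<forall>h\<in>functionals V W. \<forall>\<rho>\<in>Q. chi W \<rho> h < \<infinity> \<longrightarrow> unique_norm_extension V Q W h"
      unfolding USNP_def unique_norm_extension_def using dW HBE by metis
  next
    assume R: "\<forall>h\<in>functionals V W. \<forall>\<rho>\<in>Q. chi W \<rho> h < \<infinity> \<longrightarrow> unique_norm_extension V Q W h"
    show "USNP V Q W"
      unfolding USNP_def
    proof
      fix h assume h: "h \<in> dual V Q W"
      show "\<exists>g\<in>dual V Q (vs_carrier V). \<forall>\<rho>\<in>Q. chi W \<rho> h < \<infinity> \<longrightarrow>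
              HBE V Q W h \<rho> g \<and> (\<forall>g'. HBE V Q W h \<rho> g' \<longrightarrow> g' = g)"
      proof (cases "\<exists>\<rho>\<in>Q. chi W \<rho> h < \<infinity>")
        case True
        then obtain \<rho> where \<rho>: "\<rho> \<in> Q" "chi W \<rho> h < \<infinity>" by blast
        then obtain g where g: "\<forall>\<rho>\<in>Q. chi W \<rho> h < \<infinity> \<longrightarrow>
            norm_extension V W h \<rho> g \<and> (\<forall>g'. norm_extension V W h \<rho> g' \<longrightarrow> g' = g)"
          using R dual_functionals[OF h] unfolding unique_norm_extension_def by blast
        then have "HBE V Q W h \<rho> g" using HBE \<rho> by blast
        then have "g \<in> dual V Q (vs_carrier V)" unfolding HBE_def by blast
        then show ?thesis using g HBE by blast
      next
        \<comment> \<open>The condition on extensions is void, but \<open>USNP\<close> still asks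
          for some member of the dual; the zero functional serves.\<close>
        case False
        then show ?thesis using zero by blast
      qed
    qed
  qed
qed

lemma USNP_type_vs_iff:
  assumes "\<forall>\<rho>\<in>P. seminorm \<rho>" "subspace Y"
  shows "USNP type_vs P Y \<longleftrightarrow>
    (\<forall>h\<in>functionals type_vs Y. \<forall>\<rho>\<in>P. chi Y \<rho> h < \<infinity> \<longrightarrow> unique_norm_extension type_vs P Y h)"
  by (rule USNP_iff; (unfold type_vs_simps)?; (rule zero_in_dual)?)
    (use assms in \<open>auto intro: type_vs_functional_in_dual\<close>)

lemma USNP_quot_vs_iff:
  assumes "\<forall>\<rho>\<in>P. seminorm \<rho>" "subspace Y" "subspace Z" "Z \<subseteq> Y"
  shows "USNP (quot_vs Z) (quot_seminorm ` P) (quot Y Z) \<longleftrightarrow>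
    (\<forall>h\<in>functionals (quot_vs Z) (quot Y Z). \<forall>\<rho>\<in>P. chi (quot Y Z) (quot_seminorm \<rho>) h < \<infinity> \<longrightarrow>
       unique_norm_extension (quot_vs Z) (quot_seminorm ` P) (quot Y Z) h)"
proof -
  have carrier: "vs_carrier (quot_vs Z) = quot UNIV Z" by (simp add: quot_vs_def)
  have "USNP (quot_vs Z) (quot_seminorm ` P) (quot Y Z) \<longleftrightarrow>
    (\<forall>h\<in>functionals (quot_vs Z) (quot Y Z). \<forall>\<rho>\<in>quot_seminorm ` P. chi (quot Y Z) \<rho> h < \<infinity> \<longrightarrow>
       unique_norm_extension (quot_vs Z) (quot_seminorm ` P) (quot Y Z) h)"
  proof (rule USNP_iff, unfold carrier)
    show "(\<lambda>x\<in>quot UNIV Z. 0) \<in> dual (quot_vs Z) (quot_seminorm ` P) (quot UNIV Z)"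
      by (rule zero_in_dual) (auto simp: quot_def quot_vs_add quot_vs_scale assms(3))
  next
    have "f \<in> dual (quot_vs Z) (quot_seminorm ` P) (quot W Z)"
      if "\<rho> \<in> quot_seminorm ` P" "f \<in> functionals (quot_vs Z) (quot W Z)"
        "chi (quot W Z) \<rho> f < \<infinity>" "subspace W" "Z \<subseteq> W" for \<rho> f W
      using that quot_functional_in_dual assms(1,3) by blast
    then show "\<And>f \<rho>. \<rho> \<in> quot_seminorm ` P \<Longrightarrow> f \<in> functionals (quot_vs Z) (quot Y Z) \<Longrightarrow>
        chi (quot Y Z) \<rho> f < \<infinity> \<Longrightarrow> f \<in> dual (quot_vs Z) (quot_seminorm ` P) (quot Y Z)"
      "\<And>f \<rho>. \<rho> \<in> quot_seminorm ` P \<Longrightarrow> f \<in> functionals (quot_vs Z) (quot UNIV Z) \<Longrightarrow>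
        chi (quot UNIV Z) \<rho> f < \<infinity> \<Longrightarrow> f \<in> dual (quot_vs Z) (quot_seminorm ` P) (quot UNIV Z)"
      using assms(2,4) subspace_UNIV by blast+
  qed
  then show ?thesis by simp
qed

section \<open>Transfer of the extension problem between X/Z and X\<close>

text \<open>\<open>pull Z UNIV\<close> maps the extensions of \<open>h\<close> bijectively to those
  of \<open>pull Z Y h\<close> and preserves \<open>chi\<close>: it is injective by
  \<open>pull_inject\<close> and onto by \<open>lift\<close>. The seminorm \<open>\<rho>0\<close>
  guarantees that the common extension on X really is an extension, hence has a preimage.\<close>

lemma unique_norm_extension_pull:
  assumes sn: "\<forall>\<rho>\<in>P. seminorm \<rho>"
    and Y: "subspace Y" and Z: "subspace Z" "Z \<subseteq> Y"
    and h: "h \<in> functionals (quot_vs Z) (quot Y Z)"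
    and \<rho>0: "\<rho>0 \<in> P" "chi (quot Y Z) (quot_seminorm \<rho>0) h < \<infinity>"
  shows "unique_norm_extension (quot_vs Z) (quot_seminorm ` P) (quot Y Z) h \<longleftrightarrow>
         unique_norm_extension type_vs P Y (pull Z Y h)"
proof -
  let ?Q = "norm_extension (quot_vs Z) (quot Y Z) h"
  let ?T = "norm_extension type_vs Y (pull Z Y h)"
  have carrier: "vs_carrier (quot_vs Z) = quot UNIV Z" by (simp add: quot_vs_def)
  have chi: "chi Y \<rho> (pull Z Y h) = chi (quot Y Z) (quot_seminorm \<rho>) h" if "\<rho> \<in> P" for \<rho>
    using chi_pull[OF bspec[OF sn that] Z(1) Y Z(2) h] .
  have res: "restrict (pull Z UNIV g) Y = pull Z Y h \<longleftrightarrow> restrict g (quot Y Z) = h" for g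
  proof
    assume e: "restrict (pull Z UNIV g) Y = pull Z Y h"
    have "restrict g (quot Y Z) A = h A" if A: "A \<in> quot Y Z" for A
    proof -
      obtain y where y: "y \<in> Y" "A = coset Z y" using A unfolding quot_def by blast
      then show ?thesis using fun_cong[OF e, of y] A by (simp add: pull_def)
    qed
    moreover have "h \<in> extensional (quot Y Z)" using h by (simp add: functionals_def)
    ultimately show "restrict g (quot Y Z) = h"
      by (intro extensionalityI[of _ "quot Y Z"]) auto
  next
    assume "restrict g (quot Y Z) = h"
    then show "restrict (pull Z UNIV g) Y = pull Z Y h"
      by (auto simp: pull_def quot_def)
  qed
  have iff: "?T \<rho> (pull Z UNIV g) \<longleftrightarrow> ?Q (quot_seminorm \<rho>) g"
    if "\<rho> \<in> P" "g \<in> functionals (quot_vs Z) (quot UNIV Z)" for \<rho> g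
    using that chi[OF that(1)] res[of g] pull_functionals[OF Z(1) subspace_UNIV that(2)]
      chi_pull[OF bspec[OF sn that(1)] Z(1) subspace_UNIV _ that(2)]
    by (simp add: norm_extension_def carrier)
  \<comment> \<open>On \<open>Z\<close>, which lies in \<open>Y\<close>, an extension agrees with
    \<open>pull Z Y h\<close> and so vanishes there; therefore it descends.\<close>
  have lift: "\<exists>g'. g' \<in> functionals (quot_vs Z) (quot UNIV Z) \<and> pull Z UNIV g' = g"
    if "?T \<rho> g" for \<rho> g
  proof -
    have g: "g \<in> functionals type_vs UNIV" and ext: "restrict g Y = pull Z Y h"
      using that by (simp_all add: norm_extension_def carrier)
    have "g z = 0" if z: "z \<in> Z" for z
    proof -
      have "g z = h (coset Z z)"
        using fun_cong[OF ext, of z] z Z(2) by (auto simp: pull_def)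
      \<comment> \<open>The zero vector of the quotient is written as 0 times a coset, so that
        homogeneity of \<open>h\<close> makes its value 0.\<close>
      also have "coset Z z = vs_scale (quot_vs Z) 0 (coset Z 0)"
        using z by (simp add: quot_vs_scale[OF Z(1)] coset_eq[OF Z(1)])
      also have "h \<dots> = 0 * h (coset Z 0)"
        using h subspace_0[OF Y] by (simp add: functionals_def quot_def)
      finally show ?thesis by simp
    qed
    then show ?thesis
      using functional_vanishing_is_pull[OF Z(1) subspace_UNIV _ g] by blast
  qed
  have Qfun: "g \<in> functionals (quot_vs Z) (quot UNIV Z)" if "?Q \<rho> g" for \<rho> g
    using that by (simp add: norm_extension_def carrier)
  show ?thesis
  proof
    assume "unique_norm_extension (quot_vs Z) (quot_seminorm ` P) (quot Y Z) h"
    then obtain g where g: "\<And>\<rho>. \<rho> \<in> P \<Longrightarrow> chi (quot Y Z) (quot_seminorm \<rho>) h < \<infinity> \<Longrightarrow>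
        ?Q (quot_seminorm \<rho>) g \<and> (\<forall>g'. ?Q (quot_seminorm \<rho>) g' \<longrightarrow> g' = g)"
      unfolding unique_norm_extension_def by blast
    have "?T \<rho> (pull Z UNIV g) \<and> (\<forall>g'. ?T \<rho> g' \<longrightarrow> g' = pull Z UNIV g)"
      if "\<rho> \<in> P" "chi Y \<rho> (pull Z Y h) < \<infinity>" for \<rho>
      using g[OF that(1)] that chi[OF that(1)] iff[OF that(1)] lift Qfun by metis
    then show "unique_norm_extension type_vs P Y (pull Z Y h)"
      unfolding unique_norm_extension_def by blast
  next
    assume "unique_norm_extension type_vs P Y (pull Z Y h)"
    then obtain g0 where g0: "\<And>\<rho>. \<rho> \<in> P \<Longrightarrow> chi Y \<rho> (pull Z Y h) < \<infinity> \<Longrightarrow>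
        ?T \<rho> g0 \<and> (\<forall>g'. ?T \<rho> g' \<longrightarrow> g' = g0)"
      unfolding unique_norm_extension_def by blast
    then obtain g where g: "g \<in> functionals (quot_vs Z) (quot UNIV Z)" "pull Z UNIV g = g0"
      using lift \<rho>0 chi by metis
    have "?Q (quot_seminorm \<rho>) g \<and> (\<forall>g'. ?Q (quot_seminorm \<rho>) g' \<longrightarrow> g' = g)"
      if "\<rho> \<in> P" "chi (quot Y Z) (quot_seminorm \<rho>) h < \<infinity>" for \<rho>
      using g0[OF that(1)] that chi[OF that(1)] iff[OF that(1)] g Qfun pull_inject by metis
    then show "unique_norm_extension (quot_vs Z) (quot_seminorm ` P) (quot Y Z) h"
      unfolding unique_norm_extension_def by blast
  qed
qed

section \<open>The zero functional, kernels and hyperplanes\<close>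

text \<open>For each \<open>\<rho>\<close> in \<open>P\<close>, a functional with \<open>chi\<close>
  equal to 0 is zero. Treated without quotients, this case also covers \<open>Y = {0}\<close>, which
  has no nonzero hyperplane.\<close>

lemma unique_norm_extension_zero:
  assumes "\<forall>\<rho>\<in>P. seminorm \<rho>" "subspace Y"
  shows "unique_norm_extension type_vs P Y (\<lambda>x\<in>Y. 0)"
proof -
  have chi0: "chi W \<rho> f = 0 \<longleftrightarrow> (\<forall>x\<in>W. f x = 0)"
    if "\<rho> \<in> P" "subspace W" "f \<in> functionals type_vs W" for \<rho> f and W :: "'a set"
    using chi_le_iff[OF bspec[OF assms(1) that(1)] that(2,3), of 0] by simp
  have z: "(\<lambda>x\<in>W. 0) \<in> functionals type_vs W" if "subspace W" for W :: "'a set"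
    using subspace_add[OF that] subspace_scale[OF that] by (simp add: functionals_def type_vs_def)
  have "norm_extension type_vs Y (\<lambda>x\<in>Y. 0) \<rho> g \<longleftrightarrow> g = (\<lambda>_. 0)" if "\<rho> \<in> P" for \<rho> g
    using chi0[OF that assms(2) z[OF assms(2)]] chi0[OF that subspace_UNIV, of g]
      z[OF subspace_UNIV]
    by (auto simp: norm_extension_def restrict_UNIV)
  then show ?thesis unfolding unique_norm_extension_def by blast
qed

text \<open>Subtracting \<open>(h x / h y) *\<^sub>R y\<close> from \<open>x\<close> gives a point
  of the kernel, hence 0, so \<open>y\<close> spans \<open>Y\<close>. As \<open>dim\<close> is 0 for
  infinite-dimensional spaces, \<open>dim Y \<noteq> 1\<close> excludes lines only. On a line the
  only nonzero \<open>Z\<close> is \<open>Y\<close>, whose trivial quotient always has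
  property-USNP, while (a) can fail.\<close>

lemma dim_eq_1_if_trivial_kernel:
  fixes Y :: "'a::real_vector set"
  assumes Y: "subspace Y" and h: "h \<in> functionals type_vs Y"
    and ker: "{x \<in> Y. h x = 0} = {0}" and y: "y \<in> Y" "h y \<noteq> 0"
  shows "dim Y = 1"
proof -
  have "x \<in> span {y}" if x: "x \<in> Y" for x
  proof -
    have mem: "(- (h x / h y)) *\<^sub>R y \<in> Y" using y(1) Y subspace_scale by blast
    have "h (x + (- (h x / h y)) *\<^sub>R y) = h x + (- (h x / h y)) * h y"
      using functionals_add[OF h x mem] functionals_scale[OF h y(1), of "- (h x / h y)"] by simp
    also have "\<dots> = 0" using y(2) by simp
    finally have "x + (- (h x / h y)) *\<^sub>R y = 0"
      using ker x mem subspace_add[OF Y] by blast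
    then have "x = (h x / h y) *\<^sub>R y" by simp
    then show ?thesis by (metis span_base span_scale singletonI)
  qed
  moreover have "span {y} \<subseteq> Y" using y(1) Y by (simp add: span_minimal)
  ultimately have "Y = span {y}" by blast
  moreover have "y \<noteq> 0" using ker y by blast
  ultimately show ?thesis by (simp add: dim_eq_card_independent)
qed

text \<open>The kernel of a continuous functional is the preimage of the closed set
  \<open>{0}\<close>. This places hyperplanes among the subspaces of (b).\<close>

lemma hyperplane_subspace:
  assumes "subspace Y" "hyperplane_in type_vs P Y Z"
  shows "subspace Z" "Z \<subseteq> Y" "closedin (subtopology (seminorm_topology type_vs P) Y) Z"
proof -
  obtain f where f: "f \<in> dual type_vs P Y" and Z: "Z = {x \<in> Y. f x = 0}"
    using assms(2) unfolding hyperplane_in_def by blast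
  have "f 0 = 0"
    using functionals_scale[OF dual_functionals[OF f] subspace_0[OF assms(1)], of 0] by simp
  then show "subspace Z" "Z \<subseteq> Y"
    using f subspace_0[OF assms(1)] subspace_add[OF assms(1)] subspace_scale[OF assms(1)]
    by (auto simp: Z subspace_def dual_def type_vs_def)
  have "closedin (subtopology (seminorm_topology type_vs P) Y)
      {x \<in> topspace (subtopology (seminorm_topology type_vs P) Y). f x \<in> {0}}"
    by (rule closedin_continuous_map_preimage[where Y = euclideanreal])
      (use f in \<open>auto simp: dual_def\<close>)
  then show "closedin (subtopology (seminorm_topology type_vs P) Y) Z"
    by (simp add: Z topspace_seminorm_topology type_vs_def)
qed

section \<open>The implications between (a), (b) and (c)\<close>

text \<open>A functional on Y/Z pulls back to one on \<open>Y\<close> with the same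
  \<open>chi\<close>; its unique extension to X is carried back to X/Z.\<close>

lemma USNP_quot:
  assumes sn: "\<forall>\<rho>\<in>P. seminorm \<rho>"
    and Y: "subspace Y" and Z: "subspace Z" "Z \<subseteq> Y" and U: "USNP type_vs P Y"
  shows "USNP (quot_vs Z) (quot_seminorm ` P) (quot Y Z)"
  unfolding USNP_quot_vs_iff[OF sn Y Z]
proof (intro ballI impI)
  fix h \<rho> assume h: "h \<in> functionals (quot_vs Z) (quot Y Z)" and \<rho>: "\<rho> \<in> P"
    and fin: "chi (quot Y Z) (quot_seminorm \<rho>) h < \<infinity>"
  have "unique_norm_extension type_vs P Y (pull Z Y h)"
    using U pull_functionals[OF Z(1) Y h] \<rho> fin chi_pull[OF bspec[OF sn \<rho>] Z(1) Y Z(2) h]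
    unfolding USNP_type_vs_iff[OF sn Y] by metis
  then show "unique_norm_extension (quot_vs Z) (quot_seminorm ` P) (quot Y Z) h"
    using unique_norm_extension_pull[OF sn Y Z h \<rho> fin] by blast
qed

text \<open>A nonzero \<open>h\<close> descends to the quotient by its own kernel, where unique
  extension is assumed. \<open>dim Y \<noteq> 1\<close> makes this kernel nonzero.\<close>

lemma USNP_if_USNP_quot_hyperplanes:
  assumes sn: "\<forall>\<rho>\<in>P. seminorm \<rho>" and Y: "subspace Y" "dim Y \<noteq> 1"
    and U: "\<And>Z. hyperplane_in type_vs P Y Z \<Longrightarrow> Z \<noteq> {0} \<Longrightarrow>
              USNP (quot_vs Z) (quot_seminorm ` P) (quot Y Z)"
  shows "USNP type_vs P Y"
  unfolding USNP_type_vs_iff[OF sn Y(1)]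
proof (intro ballI impI)
  fix h \<rho> assume h: "h \<in> functionals type_vs Y" and \<rho>: "\<rho> \<in> P" and fin: "chi Y \<rho> h < \<infinity>"
  show "unique_norm_extension type_vs P Y h"
  proof (cases "\<exists>y\<in>Y. h y \<noteq> 0")
    case False
    then have "h = (\<lambda>x\<in>Y. 0)"
      using h by (auto simp: functionals_def extensional_def fun_eq_iff)
    then show ?thesis using unique_norm_extension_zero[OF sn Y(1)] by simp
  next
    case True
    define Z where "Z = {x \<in> Y. h x = 0}"
    \<comment> \<open>The finite \<open>chi\<close> makes \<open>h\<close> continuous, as the
      definition of a hyperplane requires.\<close>
    have hyp: "hyperplane_in type_vs P Y Z"
      using type_vs_functional_in_dual[OF bspec[OF sn \<rho>] \<rho> Y(1) h fin]
      unfolding hyperplane_in_def Z_def by blast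
    note Z = hyperplane_subspace(1,2)[OF Y(1) hyp]
    have "Z \<noteq> {0}" using True dim_eq_1_if_trivial_kernel[OF Y(1) h] Y(2) unfolding Z_def by blast
    then have UZ: "USNP (quot_vs Z) (quot_seminorm ` P) (quot Y Z)" using U hyp by blast
    obtain f where f: "f \<in> functionals (quot_vs Z) (quot Y Z)" "pull Z Y f = h"
      using functional_vanishing_is_pull[OF Z(1) Y(1) Z(2) h] Z_def by blast
    have fin': "chi (quot Y Z) (quot_seminorm \<rho>) f < \<infinity>"
      using fin chi_pull[OF bspec[OF sn \<rho>] Z(1) Y(1) Z(2) f(1)] f(2) by simp
    then have "unique_norm_extension (quot_vs Z) (quot_seminorm ` P) (quot Y Z) f"
      using UZ f(1) \<rho> unfolding USNP_quot_vs_iff[OF sn Y(1) Z] by blast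
    then show ?thesis
      using unique_norm_extension_pull[OF sn Y(1) Z f(1) \<rho> fin'] f(2) by simp
  qed
qed

theorem theorem3p11:
  fixes P :: "('a::real_vector \<Rightarrow> real) set" and \<tau> :: "'a topology" and Y :: "'a set"
  assumes "\<And>\<rho>. \<rho> \<in> P \<Longrightarrow> seminorm \<rho>"
    and "directed_family P"
    and "\<tau> = seminorm_topology type_vs P"
    and "subspace Y" and "closedin \<tau> Y"
    and "dim Y \<noteq> 1"
  shows "(USNP type_vs P Y \<longleftrightarrow>
          (\<forall>Z. subspace Z \<and> Z \<subseteq> Y \<and> closedin (subtopology \<tau> Y) Z \<and> Z \<noteq> {0} \<longrightarrow>
             USNP (quot_vs Z) (quot_seminorm ` P) (quot Y Z))) \<and>
         (USNP type_vs P Y \<longleftrightarrow>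
          (\<forall>Z. hyperplane_in type_vs P Y Z \<and> Z \<noteq> {0} \<longrightarrow>
             USNP (quot_vs Z) (quot_seminorm ` P) (quot Y Z)))"
proof -
  have "USNP (quot_vs Z) (quot_seminorm ` P) (quot Y Z)"
    if "USNP type_vs P Y" "subspace Z" "Z \<subseteq> Y" for Z
    using USNP_quot[of P Y Z] assms(1,4) that by blast
  \<comment> \<open>This yields the step from (b) to (c) and closes the cycle.\<close>
  moreover have "subspace Z \<and> Z \<subseteq> Y \<and> closedin (subtopology \<tau> Y) Z"
    if "hyperplane_in type_vs P Y Z" for Z
    using hyperplane_subspace[OF assms(4) that] assms(3) by blast
  moreover have "USNP type_vs P Y"
    if "\<forall>Z. hyperplane_in type_vs P Y Z \<and> Z \<noteq> {0} \<longrightarrow>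
          USNP (quot_vs Z) (quot_seminorm ` P) (quot Y Z)"
    using USNP_if_USNP_quot_hyperplanes[of P Y] assms(1,4,6) that by blast
  ultimately show ?thesis by blast
qed

end
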